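(* Let $K\subset\mathbb{R}^n$ be a non-empty closed set with medial axis $M_K$. Then $M_\infty(x;K)=0$ for every $x\in\mathbb{R}^n\setminus M_K$, and $M_\infty(x;K)>0$ for every $x\in M_K$.
   Context: $|\cdot|$ is the Euclidean norm on $\mathbb{R}^n$ and $\mathrm{dist}(x;E)=\inf\{|x-y|: y\in E\}$ for non-empty $E$; $\mathrm{co}[E]$ is the convex hull of $E$. For a non-empty closed set $K\subset\mathbb{R}^n$, the medial axis $M_K$ is the set of points $x\in\mathbb{R}^n\setminus K$ for which there are at least two different points $y_1,y_2\in K$ with $\mathrm{dist}(x;K)=|x-y_1|=|x-y_2|$. With $r(x)=\mathrm{dist}(x;K)$, put $K(x)=\overline{B}(x;r(x))\cap K$, where $\overline{B}(x;r)$ is the closed ball with centre $x$ and radius $r$. The quadratic multiscale medial axis landscape map of $K$ is $M_\infty(x;K)=\mathrm{dist}^2(x;K)-\mathrm{dist}^2(x;\mathrm{co}[K(x)])$, $x\in\mathbb{R}^n$. *)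

theory Defs
  imports "HOL-Analysis.Analysis"
begin

definition medial_axis :: "(real ^ 'n) set \<Rightarrow> (real ^ 'n) set" where
  "medial_axis K =
    {x \<in> - K. \<exists>y1\<in>K. \<exists>y2\<in>K. y1 \<noteq> y2 \<and> infdist x K = dist x y1 \<and> infdist x K = dist x y2}"

definition nearest_set :: "(real ^ 'n) set \<Rightarrow> real ^ 'n \<Rightarrow> (real ^ 'n) set" where
  "nearest_set K x = cball x (infdist x K) \<inter> K"

text \<open>
  The library sets the distance to the empty set to 0. This convention plays no role for
  non-empty closed \<open>K\<close>: the distance is then attained, so \<open>nearest_set K x\<close> is non-empty.
\<close>

definition quadratic_medial_map :: "real ^ 'n \<Rightarrow> (real ^ 'n) set \<Rightarrow> real" where
  "quadratic_medial_map x K =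
    (infdist x K)\<^sup>2 - (infdist x (convex hull (nearest_set K x)))\<^sup>2"

end

theory Submission
  imports Defs
begin

text \<open>Let r be the distance from x to \<open>K\<close>. As \<open>K\<close> is closed and
  non-empty, the nearest set is non-empty. Off the medial axis it is a single point at distance r
  (\<open>nearest_set_singleton\<close>), hence its own convex hull, and the two squares cancel. On
  the medial axis it contains two distinct points of the sphere of radius r about x; by strict
  convexity of the ball, the hull comes strictly closer to x than r
  (\<open>infdist_convex_hull_less\<close>).\<close>

text \<open>No point of \<open>K\<close> lies closer to x than the infimum, so the ball meets
  \<open>K\<close> only in its bounding sphere.\<close>

lemma nearest_set_eq:
  "nearest_set K x = {y \<in> K. dist x y = infdist x K}"
  unfolding nearest_set_def using infdist_le[of _ K x] by fastforce

lemma nearest_set_nonempty: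
  assumes "K \<noteq> {}" and "closed K"
  shows "nearest_set K x \<noteq> {}"
proof -
  obtain y where "y \<in> K" "infdist x K = dist x y"
    using infdist_attains_inf[OF assms(2,1)] .
  then have "y \<in> nearest_set K x" by (simp add: nearest_set_eq)
  then show ?thesis by blast
qed

lemma nearest_set_singleton:
  assumes "K \<noteq> {}" and "closed K" and "x \<notin> medial_axis K"
  obtains y where "nearest_set K x = {y}" and "dist x y = infdist x K"
proof -
  obtain y where y: "y \<in> nearest_set K x"
    using nearest_set_nonempty[OF assms(1,2)] by blast
  have "z = y" if z: "z \<in> nearest_set K x" for z
  proof (cases "x \<in> K")
    \<comment> \<open>Points of \<open>K\<close> are off the medial axis by definition, whatever
      their nearest points. Here the radius is 0, so \<open>y\<close> and \<open>z\<close> both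
      equal \<open>x\<close>.\<close>
    case True
    then show ?thesis using y z by (simp add: nearest_set_eq)
  next
    case False
    then show ?thesis
      using y z assms(3) unfolding medial_axis_def nearest_set_eq
      by (metis (mono_tags, lifting) ComplI mem_Collect_eq)
  qed
  then have "nearest_set K x = {y}" using y by blast
  moreover have "dist x y = infdist x K" using y by (simp add: nearest_set_eq)
  ultimately show thesis by (rule that)
qed

text \<open>The midpoint of a proper chord of a sphere lies strictly inside the ball, and it belongs
  to the hull.\<close>

lemma infdist_convex_hull_less:
  fixes x :: "'a::euclidean_space"
  assumes "y1 \<in> S" and "y2 \<in> S" and "y1 \<noteq> y2" and "dist x y1 = r" and "dist x y2 = r"
  shows "infdist x (convex hull S) < r"
proof -
  have "midpoint y1 y2 \<in> open_segment y1 y2"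
    using assms(3) by simp
  \<comment> \<open>The library fact only says that an interior point of the segment is closer to
    \<open>x\<close> than one of the two ends; as both ends are at distance \<open>r\<close>, either
    alternative suffices.\<close>
  then have "dist (midpoint y1 y2) x < r"
    using dist_decreases_open_segment[of "midpoint y1 y2" y1 y2 x] assms(4,5)
    by (auto simp: dist_commute)
  moreover have "midpoint y1 y2 \<in> convex hull S"
    using assms(1,2) closed_segment_subset_convex_hull[OF hull_inc hull_inc]
      midpoint_in_closed_segment by blast
  ultimately show ?thesis
    using infdist_le[of "midpoint y1 y2" "convex hull S" x] by (simp add: dist_commute)
qed

theorem mainTheorem4:
  fixes K :: "(real ^ 'n) set"
  assumes "K \<noteq> {}" and "closed K"
  shows "(\<forall>x. x \<notin> medial_axis K \<longrightarrow> quadratic_medial_map x K = 0) \<and>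
         (\<forall>x \<in> medial_axis K. quadratic_medial_map x K > 0)"
proof (intro conjI allI impI ballI)
  fix x assume "x \<notin> medial_axis K"
  then obtain y where "nearest_set K x = {y}" and "dist x y = infdist x K"
    using nearest_set_singleton assms by blast
  then show "quadratic_medial_map x K = 0"
    by (simp add: quadratic_medial_map_def)
next
  fix x assume "x \<in> medial_axis K"
  then obtain y1 y2 where "y1 \<in> nearest_set K x" "y2 \<in> nearest_set K x" "y1 \<noteq> y2"
    "dist x y1 = infdist x K" "dist x y2 = infdist x K"
    unfolding medial_axis_def nearest_set_eq by auto
  then have "infdist x (convex hull (nearest_set K x)) < infdist x K"
    by (rule infdist_convex_hull_less)
  then show "quadratic_medial_map x K > 0"
    by (simp add: quadratic_medial_map_def power_strict_mono infdist_nonneg)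
qed

end
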